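(* Every cycle $C$ belongs to $\mathcal{G}^{\mathrm{cs}}$; that is, for every cycle $C$ (on at least $3$ vertices) and every weight function $w$ on $V(C)$ with positive real values, $\mathrm{s}(C,w)=\mathrm{cs}(C,w)$.
   Context: All graphs are finite, simple, undirected and connected (except that induced subgraphs considered below may be disconnected). For a graph $G$ and $S\subset V(G)$, $G[S]$ is the subgraph induced by $S$ and $G-S=G[V(G)\setminus S]$. "Component" means connected component (often identified with its vertex set). A weight function $w$ on $V(G)$ is a map assigning a positive real number to each vertex; $\mathcal{W}(G)$ is the set of all weight functions on $V(G)$. For $X\subset V(G)$, $w(X)=\sum_{v\in X}w(v)$. For disjoint $A,B\subset V(G)$, $E(A,B)$ is the set of edges joining a vertex of $A$ to a vertex of $B$. A non-empty subset $S\subset V(G)$ is a weighted safe set of $(G,w)$ if for every component $C$ of $G[S]$ and every component $D$ of $G-S$, $w(C)\ge w(D)$ whenever $E(C,D)\neq\emptyset$. If moreover $G[S]$ is connected, $S$ is a connected weighted safe set. The weighted safe number is $\mathrm{s}(G,w)=\min\{w(S)\mid S$ is a weighted safe set of $(G,w)\}$, and the connected weighted safe number is $\mathrm{cs}(G,w)=\min\{w(S)\mid S$ is a connected weighted safe set of $(G,w)\}$. $\mathcal{G}^{\mathrm{cs}}$ is the family of all (connected) graphs $G$ such that $\mathrm{s}(G,w)=\mathrm{cs}(G,w)$ for every $w\in\mathcal{W}(G)$. *)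

theory Defs
  imports Complex_Main "Graph_Theory.Digraph_Component"
begin

text \<open>
  A finite simple undirected graph is a symmetric digraph in the sense of the locale
  \<^locale>\<open>graph\<close>: each undirected edge is represented by a pair of opposite arcs.  Hence the
  connected components of a graph are the strongly connected components of the digraph,
  and \<^const>\<open>pre_digraph.sccs_verts\<close> collects their (non-empty) vertex sets.
\<close>

abbreviation components :: "('a,'b) pre_digraph \<Rightarrow> 'a set set" where
  "components G \<equiv> pre_digraph.sccs_verts G"

definition delete_verts :: "('a,'b) pre_digraph \<Rightarrow> 'a set \<Rightarrow> ('a,'b) pre_digraph" where
  "delete_verts G S = G \<restriction> (verts G - S)"

definition edges_between :: "('a,'b) pre_digraph \<Rightarrow> 'a set \<Rightarrow> 'a set \<Rightarrow> 'a set set" where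
  "edges_between G A B = {{u, v} | u v. u \<in> A \<and> v \<in> B \<and> u \<rightarrow>\<^bsub>G\<^esub> v}"

text \<open>
  Weight functions are total on the vertex type; their values outside
  \<^term>\<open>verts G\<close> are unconstrained and never used.
\<close>

definition weight_functions :: "('a,'b) pre_digraph \<Rightarrow> ('a \<Rightarrow> real) set" where
  "weight_functions G = {w. \<forall>v \<in> verts G. 0 < w v}"

definition weighted_safe_set :: "('a,'b) pre_digraph \<Rightarrow> ('a \<Rightarrow> real) \<Rightarrow> 'a set \<Rightarrow> bool" where
  "weighted_safe_set G w S \<longleftrightarrow> S \<subseteq> verts G \<and> S \<noteq> {} \<and>
     (\<forall>C \<in> components (G \<restriction> S). \<forall>D \<in> components (delete_verts G S).
        edges_between G C D \<noteq> {} \<longrightarrow> sum w C \<ge> sum w D)"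

definition connected_weighted_safe_set ::
    "('a,'b) pre_digraph \<Rightarrow> ('a \<Rightarrow> real) \<Rightarrow> 'a set \<Rightarrow> bool" where
  "connected_weighted_safe_set G w S \<longleftrightarrow> weighted_safe_set G w S \<and> connected (G \<restriction> S)"

definition weighted_safe_number :: "('a,'b) pre_digraph \<Rightarrow> ('a \<Rightarrow> real) \<Rightarrow> real" where
  "weighted_safe_number G w = Min {sum w S | S. weighted_safe_set G w S}"

definition connected_weighted_safe_number :: "('a,'b) pre_digraph \<Rightarrow> ('a \<Rightarrow> real) \<Rightarrow> real" where
  "connected_weighted_safe_number G w = Min {sum w S | S. connected_weighted_safe_set G w S}"

definition cs_graphs :: "('a,'b) pre_digraph set" where
  "cs_graphs = {G. graph G \<and> connected G \<and>
     (\<forall>w \<in> weight_functions G. weighted_safe_number G w = connected_weighted_safe_number G w)}"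

text \<open>
  The library's \<^const>\<open>pre_digraph.cycle\<close> is a predicate on closed walks and, in a symmetric
  digraph, also admits the walk along an edge and back.  Here a cycle is a graph: at least
  three distinct vertices in cyclic order, with exactly the consecutive ones adjacent.
\<close>

definition cycle_graph :: "('a,'b) pre_digraph \<Rightarrow> bool" where
  "cycle_graph G \<longleftrightarrow> graph G \<and>
     (\<exists>vs. distinct vs \<and> 3 \<le> length vs \<and> verts G = set vs \<and>
        (\<forall>u v. u \<rightarrow>\<^bsub>G\<^esub> v \<longleftrightarrow>
           (\<exists>i < length vs. {u, v} = {vs ! i, vs ! (Suc i mod length vs)})))"

text \<open>
  The minima above range over finite non-empty sets, so \<^const>\<open>Min\<close> is a genuine minimum.
\<close>

lemma induce_subgraph_verts_self:
  assumes "graph G"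
  shows "G \<restriction> verts G = G"
proof -
  interpret graph G by fact
  show ?thesis by (rule pre_digraph.equality) auto
qed

lemma components_no_verts:
  assumes "verts G = {}"
  shows "components G = {}"
proof -
  have "\<not> u \<rightarrow>\<^sup>*\<^bsub>G\<^esub> v" for u v
    using assms by (metis reachable_in_vertsE empty_iff)
  then show ?thesis
    unfolding pre_digraph.sccs_verts_def by blast
qed

lemma finite_safe_set_weights:
  assumes "graph G"
  shows "finite {sum w S | S. weighted_safe_set G w S}"
    and "finite {sum w S | S. connected_weighted_safe_set G w S}"
proof -
  interpret graph G by fact
  show a: "finite {sum w S | S. weighted_safe_set G w S}"
    by (rule finite_subset[of _ "sum w ` Pow (verts G)"])
       (auto simp: weighted_safe_set_def)
  show "finite {sum w S | S. connected_weighted_safe_set G w S}"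
    by (rule finite_subset[OF _ a]) (auto simp: connected_weighted_safe_set_def)
qed

lemma connected_weighted_safe_set_verts:
  assumes "graph G" "connected G"
  shows "connected_weighted_safe_set G w (verts G)"
proof -
  have "verts G \<noteq> {}"
    using assms(2) by (auto simp: connected_def strongly_connected_def mk_symmetric_def)
  moreover have "components (delete_verts G (verts G)) = {}"
    by (rule components_no_verts) (simp add: delete_verts_def)
  ultimately show ?thesis
    using assms by (simp add: connected_weighted_safe_set_def weighted_safe_set_def
        induce_subgraph_verts_self)
qed

lemma safe_set_weights_nonempty:
  assumes "graph G" "connected G"
  shows "{sum w S | S. weighted_safe_set G w S} \<noteq> {}"
    and "{sum w S | S. connected_weighted_safe_set G w S} \<noteq> {}"
  using connected_weighted_safe_set_verts[OF assms, of w]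
  by (auto simp: connected_weighted_safe_set_def)

end

theory Submission
  imports Defs
begin

text \<open>
  A safe set \<open>S\<close> with vertices on both sides cuts the cycle into alternating blocks
  \<open>A\<^sub>1, B\<^sub>1, \<dots>, A\<^sub>k, B\<^sub>k\<close>, the \<open>A\<^sub>i\<close> being the components of \<open>S\<close> and the \<open>B\<^sub>i\<close> those of the
  rest (\<open>maximal_arc_component\<close>).  Safety says exactly that each \<open>B\<close>-block weighs at most as much as
  either \<open>A\<close>-block next to it.

  On the other hand, an arc carrying at least half of the total weight is a connected safe set
  (\<open>heavy_arc_safe\<close>).  So it suffices to find an arc whose weight lies between half of the total
  weight and the weight of \<open>S\<close>.

  Such an arc is found among the windows of \<open>k\<close> consecutive blocks (\<open>balanced_window\<close>).  Let
  \<open>\<delta> \<ge> 0\<close> be the weight of \<open>S\<close> minus the weight of the rest; then the weight of \<open>S\<close> exceeds half of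
  the total by \<open>\<delta> / 2\<close>.  The complement of a window is again a window, so it is enough that some
  window differs from half of the total by at most \<open>\<delta> / 2\<close>.  Sliding a window block by block turns
  it into its complement, hence passes from one side of half of the total to the other, and one
  slide exchanges one block for another.  So it remains to see that no two blocks differ in weight by
  more than \<open>\<delta>\<close> (\<open>difference_le_excess\<close>).  The extreme case is an \<open>A\<close>-block against a
  \<open>B\<close>-block.  Going right from this \<open>A\<close>-block, match each \<open>B\<close>-block met before the chosen one with
  the \<open>A\<close>-block to its right, and each one met after it with the \<open>A\<close>-block to its left.  All blocks
  but the chosen two are matched, so \<open>\<delta>\<close> is at least the difference of these two.
\<close>

section \<open>Balanced windows in alternating periodic sequences\<close>

lemma sum_lessThan_shift_period:
  fixes f :: "nat \<Rightarrow> real"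
  assumes "\<And>i. f (i + k) = f i"
  shows "(\<Sum>i<k. f (p + i)) = (\<Sum>i<k. f i)"
proof (induction p)
  case (Suc p)
  have "(\<Sum>i<k. f (Suc p + i)) + f p = (\<Sum>i<Suc k. f (p + i))"
    by (subst sum.lessThan_Suc_shift) (simp add: add.commute)
  also have "\<dots> = (\<Sum>i<k. f (p + i)) + f p"
    using assms[of p] by simp
  finally show ?case using Suc by simp
qed simp

lemma sum_lessThan_add:
  fixes f :: "nat \<Rightarrow> real"
  shows "(\<Sum>i<m + n. f i) = (\<Sum>i<m. f i) + (\<Sum>i<n. f (m + i))"
  by (induction n) simp_all

lemma sum_lessThan_even_odd:
  fixes x :: "nat \<Rightarrow> real"
  shows "(\<Sum>i<2 * k. x i) = (\<Sum>i<k. x (2 * i)) + (\<Sum>i<k. x (2 * i + 1))"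
  by (induction k) (simp_all add: algebra_simps)

text \<open>
  After removing \<open>a 0\<close> and \<open>b r\<close>, each \<open>b i\<close> with \<open>i < r\<close> is matched with \<open>a (Suc i)\<close> and each
  \<open>b i\<close> with \<open>i > r\<close> with \<open>a i\<close>.
\<close>

lemma difference_le_excess_from_start:
  fixes a b :: "nat \<Rightarrow> real"
  assumes "\<And>i. b i \<le> a i" and "\<And>i. b i \<le> a (Suc i)" and "r < k"
  shows "a 0 - b r \<le> (\<Sum>i<k. a i) - (\<Sum>i<k. b i)"
proof -
  obtain d where "k = Suc r + d"
    using \<open>r < k\<close> by (metis less_iff_Suc_add add_Suc_shift add_Suc)
  moreover have "a 0 - b r \<le> (\<Sum>i<Suc r + d. a i) - (\<Sum>i<Suc r + d. b i)"
  proof (induction d)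
    case 0
    have "(\<Sum>i<r. b i) \<le> (\<Sum>i<r. a (Suc i))"
      by (intro sum_mono assms)
    moreover have "(\<Sum>i<Suc r. a i) = a 0 + (\<Sum>i<r. a (Suc i))"
      by (rule sum.lessThan_Suc_shift)
    ultimately show ?case by simp
  next
    case (Suc d)
    show ?case using Suc assms(1)[of "Suc r + d"] by simp
  qed
  ultimately show ?thesis by simp
qed

text \<open>
  An even index carries the weight of a block of the safe set, an odd index that of a block of the
  rest.  The largest value occurs at an even index and the smallest at an odd one, so the preceding
  matching bounds every difference, after a shift by an even number.
\<close>

lemma difference_le_excess:
  fixes x :: "nat \<Rightarrow> real"
  assumes "0 < k" and period: "\<And>i. x (i + 2 * k) = x i"
    and right: "\<And>i. x (2 * i + 1) \<le> x (2 * i)"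
    and left: "\<And>i. x (2 * i + 1) \<le> x (2 * i + 2)"
  shows "x p - x q \<le> (\<Sum>i<k. x (2 * i)) - (\<Sum>i<k. x (2 * i + 1))"
proof -
  let ?a = "\<lambda>i. x (2 * i)" and ?b = "\<lambda>i. x (2 * i + 1)"
  have pa: "?a (i + k) = ?a i" and pb: "?b (i + k) = ?b i" for i
    using period[of "2 * i"] period[of "2 * i + 1"] by (simp_all add: algebra_simps)
  have pb': "?b (i + m * k) = ?b i" for i m
  proof (induction m)
    case (Suc m)
    then show ?case using pb[of "i + m * k"] by (simp add: algebra_simps)
  qed simp
  have ab: "?a p - ?b q \<le> (\<Sum>i<k. ?a i) - (\<Sum>i<k. ?b i)" for p q
  proof -
    \<comment> \<open>The index \<open>q\<close> is moved by a multiple of \<open>k\<close> into the period starting at \<open>p\<close>.\<close>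
    define r where "r = (q + p * k - p) mod k"
    define m where "m = (q + p * k - p) div k"
    have "p \<le> p * k" using \<open>0 < k\<close> by simp
    then have "p \<le> q + p * k" by (rule trans_le_add2)
    then have "q + p * k = (p + r) + m * k"
      unfolding r_def m_def by (simp add: algebra_simps)
    then have "?b q = ?b (p + r)"
      using pb'[of q p] pb'[of "p + r" m] by simp
    moreover have "?a (p + 0) - ?b (p + r) \<le> (\<Sum>i<k. ?a (p + i)) - (\<Sum>i<k. ?b (p + i))"
      by (rule difference_le_excess_from_start)
         (use right[of "p + _"] left[of "p + _"] \<open>0 < k\<close> in \<open>auto simp: r_def\<close>)
    ultimately show ?thesis
      using sum_lessThan_shift_period[of ?a k p] sum_lessThan_shift_period[of ?b k p] pa pb
      by simp
  qed
  have "\<exists>i. x p \<le> ?a i"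
  proof (cases "even p")
    case False
    then obtain i where "p = 2 * i + 1" by (rule oddE)
    then show ?thesis using right by blast
  qed (metis evenE order_refl)
  moreover have "\<exists>i. ?b i \<le> x q"
  proof (cases "even q")
    case True
    then obtain i where "q = 2 * i" by (rule evenE)
    then show ?thesis using right by blast
  qed (metis oddE order_refl)
  ultimately show ?thesis using ab by (meson diff_mono order_trans)
qed

text \<open>
  This is the discrete intermediate value argument: if no window weight lay in the closed interval
  between half of the total and the weight of the even positions, neither would any lie in its mirror
  image below half of the total, as complements of windows are windows; a slide across both would
  be too long.
\<close>

lemma balanced_window:
  fixes x :: "nat \<Rightarrow> real"
  assumes "0 < k" and period: "\<And>i. x (i + 2 * k) = x i"
    and right: "\<And>i. x (2 * i + 1) \<le> x (2 * i)"
    and left: "\<And>i. x (2 * i + 1) \<le> x (2 * i + 2)"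
  obtains j where "(\<Sum>i<2 * k. x i) \<le> 2 * (\<Sum>i<k. x (j + i))"
    and "(\<Sum>i<k. x (j + i)) \<le> (\<Sum>i<k. x (2 * i))"
proof -
  define W where "W j = (\<Sum>i<k. x (j + i))" for j
  define T where "T = (\<Sum>i<2 * k. x i)"
  define A where "A = (\<Sum>i<k. x (2 * i))"
  define B where "B = (\<Sum>i<k. x (2 * i + 1))"
  have T: "T = A + B"
    unfolding T_def A_def B_def by (rule sum_lessThan_even_odd)
  have complement: "W j + W (j + k) = T" for j
  proof -
    have "W j + W (j + k) = (\<Sum>i<k + k. x (j + i))"
      unfolding W_def sum_lessThan_add by (simp add: add.assoc)
    also have "\<dots> = T"
      using sum_lessThan_shift_period[of x "2 * k" j] period by (simp add: T_def mult_2)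
    finally show ?thesis .
  qed
  have step: "W (Suc j) - W j \<le> A - B" for j
  proof -
    have "W (Suc j) + x j = (\<Sum>i<Suc k. x (j + i))"
      unfolding W_def by (subst sum.lessThan_Suc_shift) simp
    then have "W (Suc j) - W j = x (j + k) - x j"
      by (simp add: W_def)
    then show ?thesis
      using difference_le_excess[OF assms] by (simp add: A_def B_def)
  qed
  have "\<exists>j. T \<le> 2 * W j \<and> W j \<le> A"
  proof (rule ccontr)
    assume "\<nexists>j. T \<le> 2 * W j \<and> W j \<le> A"
    then have none: "A < W j" if "T \<le> 2 * W j" for j
      using that by (meson not_le)
    have "B \<le> A"
      using difference_le_excess[OF assms, of 0 0] by (simp add: A_def B_def)
    obtain j where j: "2 * W j < T"
    proof (cases "2 * W 0 < T")
      case False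
      then have "A < W 0" by (intro none) simp
      then show thesis using complement[of 0] T \<open>B \<le> A\<close> that[of k] by simp
    qed
    \<comment> \<open>A window below half would stay below half when it slides, yet \<open>k\<close> slides
        turn it into its complement, which is above half.\<close>
    have "2 * W (j + l) < T" for l
    proof (induction l)
      case (Suc l)
      have "T \<le> 2 * W (j + l + k)" using complement[of "j + l"] Suc by simp
      then have "A < W (j + l + k)" by (rule none)
      then have "W (j + l) < B" using complement[of "j + l"] T by simp
      then have "W (j + Suc l) < A" using step[of "j + l"] by simp
      then have "\<not> T \<le> 2 * W (j + Suc l)" using none[of "j + Suc l"] by linarith
      then show ?case by simp
    qed (use j in simp)
    from this[of k] j complement[of j] show False by simp
  qed
  then show thesis using that by (auto simp: W_def T_def A_def)
qed

section \<open>Cyclic orders of the vertices of a cycle\<close>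

text \<open>
  The index ranges over all natural numbers, read modulo the length, so that rotating the list is a
  mere shift of the index.
\<close>

definition cyclic_order :: "('a,'b) pre_digraph \<Rightarrow> 'a list \<Rightarrow> bool" where
  "cyclic_order G vs \<longleftrightarrow> distinct vs \<and> verts G = set vs \<and>
     (\<forall>u v. u \<rightarrow>\<^bsub>G\<^esub> v \<longleftrightarrow>
        vs \<noteq> [] \<and> (\<exists>i. {u, v} = {vs ! (i mod length vs), vs ! (Suc i mod length vs)}))"

lemma cycle_graph_cyclic_order:
  assumes "cycle_graph G"
  obtains vs where "cyclic_order G vs" and "vs \<noteq> []"
proof -
  obtain vs where vs: "distinct vs" "3 \<le> length vs" "verts G = set vs"
    "\<And>u v. u \<rightarrow>\<^bsub>G\<^esub> v \<longleftrightarrow> (\<exists>i<length vs. {u, v} = {vs ! i, vs ! (Suc i mod length vs)})"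
    using assms unfolding cycle_graph_def by blast
  have "(\<exists>i<length vs. {u, v} = {vs ! i, vs ! (Suc i mod length vs)}) \<longleftrightarrow>
      (\<exists>i. {u, v} = {vs ! (i mod length vs), vs ! (Suc i mod length vs)})" (is "?l \<longleftrightarrow> ?r") for u v
  proof
    assume ?l
    then show ?r by (metis mod_less)
  next
    assume ?r
    then obtain i where "{u, v} = {vs ! (i mod length vs), vs ! (Suc i mod length vs)}" by blast
    then show ?l
      using vs(2) by (intro exI[of _ "i mod length vs"] conjI mod_less_divisor) (auto simp: mod_Suc_eq)
  qed
  then have "cyclic_order G vs" "vs \<noteq> []"
    using vs by (auto simp: cyclic_order_def)
  then show thesis by (rule that)
qed

lemma cyclic_order_rotate:
  assumes "cyclic_order G vs"
  shows "cyclic_order G (rotate m vs)"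
proof (cases "vs = []")
  case False
  let ?n = "length vs"
  have nth: "rotate m vs ! (i mod ?n) = vs ! ((m + i) mod ?n)" for i
    using False by (simp add: nth_rotate mod_add_right_eq)
  have "(\<exists>i. {u, v} = {vs ! (i mod ?n), vs ! (Suc i mod ?n)}) \<longleftrightarrow>
      (\<exists>i. {u, v} = {vs ! ((m + i) mod ?n), vs ! (Suc (m + i) mod ?n)})" (is "?l \<longleftrightarrow> ?r") for u v
  proof
    assume ?l
    then obtain i where i: "{u, v} = {vs ! (i mod ?n), vs ! (Suc i mod ?n)}" by blast
    have "m \<le> m * ?n" using False by (cases ?n) auto
    then have "m + (i + m * ?n - m) = i + m * ?n" by (intro le_add_diff_inverse trans_le_add2)
    moreover have "Suc (i + m * ?n) mod ?n = Suc i mod ?n"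
      by (metis add_Suc mod_mult_self1)
    ultimately show ?r
      using i by (intro exI[of _ "i + m * ?n - m"]) simp
  qed blast
  then show ?thesis
    using assms False nth[of "Suc _"] by (simp add: cyclic_order_def nth)
qed (use assms in simp)

lemma cyclic_order_commute:
  "cyclic_order G (xs @ ys) \<Longrightarrow> cyclic_order G (ys @ xs)"
  by (metis cyclic_order_rotate rotate_append)

text \<open>
  An arc of the cycle is represented by a list \<open>xs\<close> that starts some cyclic order \<open>xs @ ys\<close>, the list
  \<open>ys\<close> being the complementary arc.  Up to rotation, this lemma gives all edges of the cycle,
  and the next one says that there are no others.
\<close>

lemma cyclic_order_adjacent:
  assumes "cyclic_order G (xs @ u # v # ys)"
  shows "u \<rightarrow>\<^bsub>G\<^esub> v" and "v \<rightarrow>\<^bsub>G\<^esub> u"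
proof -
  let ?vs = "xs @ u # v # ys"
  have e: "{u, v} = {?vs ! (length xs mod length ?vs), ?vs ! (Suc (length xs) mod length ?vs)}"
    by (simp add: nth_append)
  have adj: "p \<rightarrow>\<^bsub>G\<^esub> q"
    if "{p, q} = {?vs ! (length xs mod length ?vs), ?vs ! (Suc (length xs) mod length ?vs)}" for p q
  proof -
    have "\<exists>i. {p, q} = {?vs ! (i mod length ?vs), ?vs ! (Suc i mod length ?vs)}"
      using that by (rule exI)
    moreover have "?vs \<noteq> []" by simp
    ultimately show ?thesis using assms unfolding cyclic_order_def by presburger
  qed
  show "u \<rightarrow>\<^bsub>G\<^esub> v" by (rule adj[OF e])
  show "v \<rightarrow>\<^bsub>G\<^esub> u" by (rule adj[OF trans[OF insert_commute e]])
qed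

lemma cyclic_order_neighbour:
  assumes cyc: "cyclic_order G (u # zs)" and "u \<rightarrow>\<^bsub>G\<^esub> v"
  shows "v = hd (zs @ [u]) \<or> v = last (u # zs)"
proof -
  let ?vs = "u # zs" and ?n = "Suc (length zs)"
  obtain i where "{u, v} = {?vs ! (i mod ?n), ?vs ! (Suc i mod ?n)}"
    using assms unfolding cyclic_order_def by auto
  then consider "u = ?vs ! (i mod ?n)" "v = ?vs ! (Suc i mod ?n)"
    | "u = ?vs ! (Suc i mod ?n)" "v = ?vs ! (i mod ?n)"
    by (metis doubleton_eq_iff)
  \<comment> \<open>By distinctness, \<open>u\<close> occurs only at the head of the list.\<close>
  moreover have index_0: "j mod ?n = 0" if "u = ?vs ! (j mod ?n)" for j
  proof (rule ccontr)
    assume "j mod ?n \<noteq> 0"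
    then obtain l where l: "j mod ?n = Suc l" by (meson not0_implies_Suc)
    then have "l < length zs" using mod_less_divisor[of ?n j] by simp
    then have "u \<in> set zs" using that l by simp
    then show False using cyc by (simp add: cyclic_order_def)
  qed
  ultimately show ?thesis
  proof cases
    case 1
    then have "v = ?vs ! (1 mod ?n)" using index_0[of i] by (metis One_nat_def mod_Suc_eq)
    then show ?thesis by (cases zs) auto
  next
    case 2
    then have "i mod ?n = length zs"
      using index_0[of "Suc i"] by (metis mod_Suc nat.distinct(1) nat.inject)
    then show ?thesis using 2 by (simp add: last_conv_nth nth_Cons')
  qed
qed

lemma cyclic_order_concat_rotate:
  assumes "cyclic_order G (concat bs)"
  shows "cyclic_order G (concat (rotate j bs))"
proof -
  let ?m = "j mod length bs"
  have "cyclic_order G (concat (take ?m bs) @ concat (drop ?m bs))"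
    using assms by (simp flip: concat_append)
  then show ?thesis
    by (simp add: rotate_drop_take cyclic_order_commute)
qed

section \<open>Arcs of a cycle\<close>

lemma dominates_induce_subgraph_iff:
  "u \<rightarrow>\<^bsub>G \<restriction> U\<^esub> v \<longleftrightarrow> u \<rightarrow>\<^bsub>G\<^esub> v \<and> u \<in> U \<and> v \<in> U"
  by (auto simp: arcs_ends_conv)

lemma sym_digraph_induce_subgraph:
  assumes "graph G"
  shows "sym_digraph (G \<restriction> U)"
proof -
  interpret graph G by fact
  interpret H: wf_digraph "G \<restriction> U" by (rule wellformed_induce_subgraph)
  have "symmetric (G \<restriction> U)"
    unfolding symmetric_def
    by (rule symI) (use graph_symmetric in \<open>unfold dominates_induce_subgraph_iff, blast\<close>)
  then show ?thesis by (rule H.sym_digraphI)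
qed

lemma arc_reachable:
  assumes "graph G" and "cyclic_order G (xs @ ys)" and "set xs \<subseteq> U"
    and "u \<in> set xs" "v \<in> set xs"
  shows "u \<rightarrow>\<^sup>*\<^bsub>G \<restriction> U\<^esub> v"
proof -
  interpret H: sym_digraph "G \<restriction> U" by (rule sym_digraph_induce_subgraph) fact
  have from_hd: "hd bs \<rightarrow>\<^sup>*\<^bsub>G \<restriction> U\<^esub> w"
    if "cyclic_order G (as @ bs @ ys)" "set bs \<subseteq> U" "w \<in> set bs" for as bs w
    using that
  proof (induction bs arbitrary: as)
    case (Cons b bs)
    show ?case
    proof (cases "w = b")
      case True
      then show ?thesis using Cons.prems by simp
    next
      case False
      then obtain c cs where bs: "bs = c # cs" using Cons.prems by (cases bs) auto
      have "b \<rightarrow>\<^bsub>G \<restriction> U\<^esub> c"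
        using Cons.prems cyclic_order_adjacent(1)[of G as b c "cs @ ys"]
        by (simp add: bs dominates_induce_subgraph_iff)
      moreover have "c \<rightarrow>\<^sup>*\<^bsub>G \<restriction> U\<^esub> w"
        using Cons.IH[of "as @ [b]"] Cons.prems False by (simp add: bs)
      ultimately show ?thesis by (simp add: H.adj_reachable_trans)
    qed
  qed simp
  have "hd xs \<rightarrow>\<^sup>*\<^bsub>G \<restriction> U\<^esub> u" "hd xs \<rightarrow>\<^sup>*\<^bsub>G \<restriction> U\<^esub> v"
    using from_hd[of "[]" xs] assms by simp_all
  then show ?thesis
    by (rule H.reachable_trans[OF H.symmetric_reachable'])
qed

lemma connected_arc:
  assumes "graph G" and "cyclic_order G (xs @ ys)" and "xs \<noteq> []"
  shows "connected (G \<restriction> set xs)"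
proof -
  interpret H: sym_digraph "G \<restriction> set xs" by (rule sym_digraph_induce_subgraph) fact
  show ?thesis
    unfolding connected_def
  proof (rule strongly_connectedI)
    fix u v
    assume "u \<in> verts (with_proj (mk_symmetric (G \<restriction> set xs)))"
      and "v \<in> verts (with_proj (mk_symmetric (G \<restriction> set xs)))"
    then show "u \<rightarrow>\<^sup>*\<^bsub>with_proj (mk_symmetric (G \<restriction> set xs))\<^esub> v"
      by (intro H.reachable_mk_symmetricI arc_reachable[OF assms(1,2)]) simp_all
  qed (use assms(3) in simp)
qed

text \<open>
  The only edges leaving an arc go to the two vertices next to its ends, which are the first and the
  last vertex of the complementary arc.
\<close>

lemma maximal_arc_component:
  assumes "graph G" and cyc: "cyclic_order G (xs @ ys)" and "xs \<noteq> []" "ys \<noteq> []"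
    and "set xs \<subseteq> U" "hd ys \<notin> U" "last ys \<notin> U"
  shows "set xs \<in> components (G \<restriction> U)"
proof -
  interpret H: sym_digraph "G \<restriction> U" by (rule sym_digraph_induce_subgraph) fact
  have closed: "v \<in> set xs" if "u \<in> set xs" "u \<rightarrow>\<^bsub>G \<restriction> U\<^esub> v" for u v
  proof -
    have v: "v \<in> U" "u \<rightarrow>\<^bsub>G\<^esub> v" using that by (auto simp: dominates_induce_subgraph_iff)
    obtain as bs where xs: "xs = as @ u # bs" using split_list[OF \<open>u \<in> set xs\<close>] by blast
    have "cyclic_order G (u # bs @ ys @ as)"
      using cyclic_order_commute[of G as "u # bs @ ys"] cyc by (simp add: xs)
    from cyclic_order_neighbour[OF this v(2)]
    have "v = hd (bs @ ys) \<or> v = last (ys @ as)"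
      using \<open>ys \<noteq> []\<close> by (cases ys) (auto simp: hd_append last_append split: if_splits)
    then show ?thesis
      using assms(4,6,7) v(1) by (cases as rule: rev_cases; cases bs) (auto simp: xs)
  qed
  have stays: "v \<in> set xs" if "u \<rightarrow>\<^sup>*\<^bsub>G \<restriction> U\<^esub> v" "u \<in> set xs" for u v
    using that by (induction rule: H.reachable_induct) (auto intro: closed)
  show ?thesis
    unfolding pre_digraph.sccs_verts_def mem_Collect_eq
  proof (intro conjI ballI allI impI)
    show "set xs \<noteq> {}" using assms(3) by simp
    show "u \<rightarrow>\<^sup>*\<^bsub>G \<restriction> U\<^esub> v" if "u \<in> set xs" "v \<in> set xs" for u v
      using arc_reachable[OF assms(1) cyc assms(5) that] .
    show "\<not> u \<rightarrow>\<^sup>*\<^bsub>G \<restriction> U\<^esub> v \<or> \<not> v \<rightarrow>\<^sup>*\<^bsub>G \<restriction> U\<^esub> u" if "u \<in> set xs" "v \<notin> set xs" for u v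
      using stays that by blast
  qed
qed

text \<open>
  The arc is the only component of the graph that it induces, and a component of the rest weighs at
  most as much as the whole rest.
\<close>

lemma heavy_arc_safe:
  assumes "graph G" and cyc: "cyclic_order G (xs @ ys)" and "xs \<noteq> []"
    and pos: "w \<in> weight_functions G"
    and heavy: "sum w (set ys) \<le> sum w (set xs)"
  shows "connected_weighted_safe_set G w (set xs)"
proof -
  interpret graph G by fact
  have V: "verts G = set xs \<union> set ys" "set xs \<inter> set ys = {}"
    using cyc by (auto simp: cyclic_order_def)
  have rest: "verts G - set xs = set ys" using V by auto
  have "sum w D \<le> sum w C" if "C \<in> components (G \<restriction> set xs)"
    and "D \<in> components (delete_verts G (set xs))" for C D
  proof -
    interpret H: wf_digraph "G \<restriction> set xs" by (rule wellformed_induce_subgraph)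
    interpret K: wf_digraph "G \<restriction> set ys" by (rule wellformed_induce_subgraph)
    have "C \<noteq> {}" "C \<subseteq> set xs"
      using that(1) H.sccs_verts_subsets by (auto simp: H.in_sccs_verts_conv_reachable)
    moreover have "v \<in> C" if "u \<in> C" "v \<in> set xs" for u v
      using \<open>C \<in> _\<close> that \<open>C \<subseteq> set xs\<close> arc_reachable[OF assms(1,2) order_refl, of u v]
        arc_reachable[OF assms(1,2) order_refl, of v u]
      by (auto simp: H.in_sccs_verts_conv_reachable)
    ultimately have "C = set xs" by blast
    moreover have "D \<subseteq> set ys"
      using that(2) K.sccs_verts_subsets by (auto simp: delete_verts_def rest)
    then have "sum w D \<le> sum w (set ys)"
      using pos V by (intro sum_mono2) (auto simp: weight_functions_def less_imp_le)
    ultimately show ?thesis using heavy by simp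
  qed
  then show ?thesis
    using assms(3) V connected_arc[OF assms(1-3)]
    by (auto simp: connected_weighted_safe_set_def weighted_safe_set_def)
qed

section \<open>Decomposition into blocks\<close>

text \<open>
  The blocks are the maximal runs of elements that agree on \<open>P\<close>.
\<close>

lemma alternating_blocks:
  assumes "xs \<noteq> []"
  obtains bs where "concat bs = xs" and "bs \<noteq> []" and "[] \<notin> set bs"
    and "\<And>i v. i < length bs \<Longrightarrow> v \<in> set (bs ! i) \<Longrightarrow> P v \<longleftrightarrow> (even i \<longleftrightarrow> P (hd xs))"
proof -
  have "\<exists>bs. concat bs = xs \<and> bs \<noteq> [] \<and> [] \<notin> set bs \<and>
      (\<forall>i<length bs. \<forall>v\<in>set (bs ! i). P v \<longleftrightarrow> (even i \<longleftrightarrow> P (hd xs)))"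
    using assms
  proof (induction xs rule: list_nonempty_induct)
    case (single x)
    show ?case by (rule exI[of _ "[[x]]"]) simp
  next
    case (cons x xs)
    then obtain bs where bs: "concat bs = xs" "bs \<noteq> []" "[] \<notin> set bs"
      "\<forall>i<length bs. \<forall>v\<in>set (bs ! i). P v \<longleftrightarrow> (even i \<longleftrightarrow> P (hd xs))" by blast
    show ?case
    proof (cases "P x \<longleftrightarrow> P (hd xs)")
      case True
      from bs(2) obtain c cs where c: "bs = c # cs" by (cases bs) auto
      show ?thesis
        by (rule exI[of _ "(x # c) # cs"])
           (use bs True c in \<open>auto simp: nth_Cons split: nat.splits\<close>)
    next
      case False
      show ?thesis
        by (rule exI[of _ "[x] # bs"])
           (use bs False in \<open>auto simp: nth_Cons split: nat.splits\<close>)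
    qed
  qed
  then show thesis using that by blast
qed

lemma last_concat:
  assumes "bs \<noteq> []" and "last bs \<noteq> []"
  shows "last (concat bs) = last (last bs)"
  using assms by (induction bs) (auto simp: last_append)

lemma sum_set_concat:
  fixes w :: "'a \<Rightarrow> real"
  assumes "distinct (concat bs)"
  shows "sum w (set (concat bs)) = (\<Sum>i<length bs. sum w (set (bs ! i)))"
  using assms
proof (induction bs)
  case (Cons b bs)
  then have "sum w (set (concat (b # bs))) = sum w (set b) + sum w (set (concat bs))"
    by (subst sum.union_disjoint[symmetric]) auto
  moreover have "(\<Sum>i<length (b # bs). sum w (set ((b # bs) ! i))) =
      sum w (set b) + (\<Sum>i<length bs. sum w (set (bs ! i)))"
    by (simp add: sum.lessThan_Suc_shift del: sum.lessThan_Suc)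
  ultimately show ?case using Cons by simp
qed simp

text \<open>
  A cyclic order that starts in \<open>S\<close> and ends outside \<open>S\<close> is cut into an even number of blocks, and
  no block wraps around the end of the list.
\<close>

lemma cyclic_order_start_in_end_out:
  assumes "cyclic_order G vs" and "S \<subseteq> verts G" "S \<noteq> {}" "S \<noteq> verts G"
  obtains us where "cyclic_order G us" "us \<noteq> []" "hd us \<in> S" "last us \<notin> S"
proof -
  have V: "verts G = set vs" using assms(1) by (simp add: cyclic_order_def)
  obtain s where s: "s \<in> S" "s \<in> set vs" using assms(2,3) V by blast
  obtain as bs where vs: "vs = as @ s # bs" using split_list[OF s(2)] by blast
  have "\<exists>y\<in>set (s # bs @ as). y \<notin> S"
    using assms(2,4) V vs by auto
  then obtain ps y qs where y: "s # bs @ as = ps @ y # qs" "y \<notin> S" "\<forall>z\<in>set qs. z \<in> S"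
    using split_list_last_prop[of "s # bs @ as" "\<lambda>y. y \<notin> S"] by auto
  have "cyclic_order G ((s # bs) @ as)"
    using assms(1) vs by (simp only: cyclic_order_commute)
  then have "cyclic_order G ((ps @ [y]) @ qs)" using y(1) by simp
  then have "cyclic_order G (qs @ ps @ [y])" by (rule cyclic_order_commute)
  moreover have "hd (qs @ ps @ [y]) \<in> S"
    using y s(1) by (cases qs; cases ps) auto
  ultimately show thesis using y(2) by (intro that) auto
qed

section \<open>Safe sets of a cycle\<close>

text \<open>
  The blocks of the cyclic order are indexed by all natural numbers, modulo their number \<open>2 * k\<close>;
  those with even index are the components of \<open>S\<close>.  The set sought is a balanced window of \<open>k\<close>
  consecutive blocks.
\<close>

lemma lighter_connected_safe_set:
  assumes "graph G" and "cyclic_order G vs" and pos: "w \<in> weight_functions G"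
    and safe: "weighted_safe_set G w S" and "S \<noteq> verts G"
  obtains A where "connected_weighted_safe_set G w A" and "sum w A \<le> sum w S"
proof -
  have S: "S \<subseteq> verts G" "S \<noteq> {}" using safe by (auto simp: weighted_safe_set_def)
  obtain us where us: "cyclic_order G us" "us \<noteq> []" "hd us \<in> S" "last us \<notin> S"
    using cyclic_order_start_in_end_out[OF assms(2) S assms(5)] by blast
  obtain bs where bs: "concat bs = us" "bs \<noteq> []" "[] \<notin> set bs"
    and "\<And>i v. i < length bs \<Longrightarrow> v \<in> set (bs ! i) \<Longrightarrow> v \<in> S \<longleftrightarrow> (even i \<longleftrightarrow> hd us \<in> S)"
    using alternating_blocks[OF us(2), of "\<lambda>v. v \<in> S"] by blast
  then have side: "v \<in> S \<longleftrightarrow> even i" if "i < length bs" "v \<in> set (bs ! i)" for i v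
    using that us(3) by blast
  have "last bs \<noteq> []" using bs(2,3) last_in_set by metis
  then have "last us = last (last bs)" using bs last_concat by blast
  then have "last us \<in> set (bs ! (length bs - 1))"
    using bs(2) \<open>last bs \<noteq> []\<close> by (simp add: last_conv_nth)
  then have "odd (length bs - 1)"
    using side[of "length bs - 1"] bs(2) us(4) by simp
  then have "even (length bs)" using bs(2) by simp
  then obtain k where "length bs = 2 * k" by (rule evenE)
  then have k: "length bs = 2 * k" "0 < k" using bs(2) by (auto simp flip: length_greater_0_conv)
  define blk where "blk i = bs ! (i mod (2 * k))" for i
  define x where "x i = sum w (set (blk i))" for i
  have blk_mem: "blk i \<in> set bs" for i
    using k by (simp add: blk_def)
  then have blk: "blk i \<noteq> []" for i
    using bs(3) by metis
  have blk_side: "v \<in> S \<longleftrightarrow> even i" if "v \<in> set (blk i)" for i v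
    using side[of "i mod (2 * k)" v] that k by (simp add: blk_def dvd_mod_iff)
  have blk_verts: "set (blk i) \<subseteq> verts G" for i
    using blk_mem[of i] us(1) bs(1) by (auto simp: cyclic_order_def)
  have rotated: "cyclic_order G (concat (rotate j bs))" for j
    by (rule cyclic_order_concat_rotate) (simp add: bs(1) us(1))
  have nth_rotated: "rotate j bs ! i = blk (j + i)" if "i < 2 * k" for i j
    using that k by (simp add: nth_rotate blk_def add.commute)

  \<comment> \<open>Rotated so that block \<open>i\<close> comes first, the cyclic order exhibits it as an arc
      and shows both of its ends.\<close>
  have "set (blk i) \<in> components (G \<restriction> (if even i then S else verts G - S)) \<and>
      last (blk i) \<rightarrow>\<^bsub>G\<^esub> hd (blk (Suc i)) \<and> hd (blk (Suc i)) \<rightarrow>\<^bsub>G\<^esub> last (blk i)" for i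
  proof -
    obtain cs where cs: "rotate i bs = blk i # blk (Suc i) # cs"
    proof -
      have "length (rotate i bs) = Suc (Suc (2 * k - 2))" using k by simp
      then obtain b c cs where "rotate i bs = b # c # cs"
        by (metis length_Suc_conv)
      then show thesis
        using that nth_rotated[of 0 i] nth_rotated[of 1 i] k by simp
    qed
    define ds where "ds = blk (Suc i) # cs"
    have ds: "rotate i bs = blk i # ds" "ds \<noteq> []" "length ds = 2 * k - 1"
      using cs k length_rotate[of i bs] by (auto simp: ds_def)
    have "last ds = rotate i bs ! (2 * k - 1)"
      using ds k by (simp add: last_conv_nth nth_Cons')
    then have last_ds: "last ds = blk (i + (2 * k - 1))"
      using nth_rotated[of "2 * k - 1" i] k by simp
    have hd_concat: "hd (concat ds) = hd (blk (Suc i))"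
      using blk by (simp add: ds_def)
    have last_of_rest: "last (concat ds) = last (blk (i + (2 * k - 1)))"
      using last_ds ds(2) blk by (simp add: last_concat)
    have "set (blk i) \<in> components (G \<restriction> (if even i then S else verts G - S))"
    proof (rule maximal_arc_component[OF assms(1)])
      show "cyclic_order G (blk i @ concat ds)" using rotated[of i] ds by simp
      show "blk i \<noteq> []" "concat ds \<noteq> []" using blk by (auto simp: ds_def)
      show "set (blk i) \<subseteq> (if even i then S else verts G - S)"
        using blk_side blk_verts by auto
      show "hd (concat ds) \<notin> (if even i then S else verts G - S)"
        using blk_side[OF hd_in_set[OF blk[of "Suc i"]]] by (simp add: hd_concat)
      show "last (concat ds) \<notin> (if even i then S else verts G - S)"
        using blk_side[OF last_in_set[OF blk[of "i + (2 * k - 1)"]]] k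
        by (auto simp: last_of_rest)
    qed
    moreover
    have "blk i = butlast (blk i) @ [last (blk i)]"
      "blk (Suc i) = hd (blk (Suc i)) # tl (blk (Suc i))" using blk by simp_all
    then have "concat (rotate i bs) =
        butlast (blk i) @ last (blk i) # hd (blk (Suc i)) # tl (blk (Suc i)) @ concat cs"
      unfolding cs by (metis append_Cons append_Nil append_assoc concat.simps(2))
    then have consecutive: "cyclic_order G
        (butlast (blk i) @ last (blk i) # hd (blk (Suc i)) # tl (blk (Suc i)) @ concat cs)"
      using rotated[of i] by simp
    ultimately show ?thesis
      using cyclic_order_adjacent[OF consecutive] by simp
  qed
  then have component: "set (blk i) \<in> components (G \<restriction> (if even i then S else verts G - S))"
    and adjacent: "last (blk i) \<rightarrow>\<^bsub>G\<^esub> hd (blk (Suc i))" "hd (blk (Suc i)) \<rightarrow>\<^bsub>G\<^esub> last (blk i)" for i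
    by blast+
  have heavier: "x j \<le> x i"
    if "even i" "odd j" "u \<in> set (blk i)" "v \<in> set (blk j)" "u \<rightarrow>\<^bsub>G\<^esub> v" for i j u v
  proof -
    have "edges_between G (set (blk i)) (set (blk j)) \<noteq> {}"
      unfolding edges_between_def using that(3-5) by blast
    moreover have "set (blk i) \<in> components (G \<restriction> S)"
      using component[of i] that(1) by simp
    moreover have "set (blk j) \<in> components (delete_verts G S)"
      using component[of j] that(2) by (simp add: delete_verts_def)
    ultimately show ?thesis
      using safe unfolding weighted_safe_set_def x_def by blast
  qed
  have right: "x (2 * i + 1) \<le> x (2 * i)" for i
    using adjacent(1)[of "2 * i"] blk
    by (intro heavier[where u = "last (blk (2 * i))" and v = "hd (blk (2 * i + 1))"]) simp_all
  have left: "x (2 * i + 1) \<le> x (2 * i + 2)" for i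
    using adjacent(2)[of "2 * i + 1"] blk
    by (intro heavier[where u = "hd (blk (2 * i + 2))" and v = "last (blk (2 * i + 1))"]) simp_all
  have period: "x (i + 2 * k) = x i" for i by (simp add: x_def blk_def)
  obtain j where j: "(\<Sum>i<2 * k. x i) \<le> 2 * (\<Sum>i<k. x (j + i))"
    "(\<Sum>i<k. x (j + i)) \<le> (\<Sum>i<k. x (2 * i))"
    using balanced_window[OF k(2) period right left] by blast

  define A where "A = concat (take k (rotate j bs))"
  define B where "B = concat (drop k (rotate j bs))"
  have AB: "cyclic_order G (A @ B)"
    using rotated[of j] by (simp add: A_def B_def flip: concat_append)
  then have "distinct A" "distinct B" "set A \<inter> set B = {}" "verts G = set A \<union> set B"
    by (auto simp: cyclic_order_def)
  have wA: "sum w (set A) = (\<Sum>i<k. x (j + i))"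
    using sum_set_concat[of "take k (rotate j bs)" w] \<open>distinct A\<close> k nth_rotated[of _ j]
    by (simp add: A_def x_def)
  have blocks: "sum f (verts G) = (\<Sum>i<2 * k. sum f (set (blk i)))" for f :: "'a \<Rightarrow> real"
    using sum_set_concat[of bs f] us(1) bs(1) k by (simp add: cyclic_order_def blk_def)
  have "sum w (set A) + sum w (set B) = (\<Sum>i<2 * k. x i)"
    using blocks[of w] \<open>set A \<inter> set B = {}\<close> \<open>verts G = _\<close>
    by (simp add: sum.union_disjoint x_def)
  then have heavy: "sum w (set B) \<le> sum w (set A)" using j(1) wA by simp
  \<comment> \<open>The even-indexed blocks make up exactly \<open>S\<close>.\<close>
  have "sum w S = (\<Sum>v\<in>verts G. if v \<in> S then w v else 0)"
    using S(1) us(1) by (simp add: sum.inter_restrict[symmetric] cyclic_order_def Int_absorb1)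
  also have "\<dots> = (\<Sum>i<2 * k. if even i then x i else 0)"
    unfolding blocks
  proof (rule sum.cong[OF refl])
    fix i
    have "(\<Sum>v\<in>set (blk i). if v \<in> S then w v else 0) =
        (\<Sum>v\<in>set (blk i). if even i then w v else 0)"
      by (rule sum.cong) (simp_all add: blk_side)
    then show "(\<Sum>v\<in>set (blk i). if v \<in> S then w v else 0) = (if even i then x i else 0)"
      by (simp add: x_def)
  qed
  also have "\<dots> = (\<Sum>i<k. x (2 * i))"
    by (simp add: sum_lessThan_even_odd)
  finally have "sum w (set A) \<le> sum w S" using j(2) wA by simp
  moreover have "A \<noteq> []"
    using k bs(2,3) nth_rotated[of 0 j] blk[of j] by (cases "rotate j bs"; cases k) (auto simp: A_def)
  then have "connected_weighted_safe_set G w (set A)"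
    using heavy_arc_safe[OF assms(1) AB _ pos heavy] by blast
  ultimately show thesis by (rule that[rotated])
qed

theorem theorem1p4:
  fixes C :: "('a,'b) pre_digraph"
  assumes "cycle_graph C"
  shows "C \<in> cs_graphs"
proof -
  have graph: "graph C" using assms by (simp add: cycle_graph_def)
  obtain vs where vs: "cyclic_order C vs" "vs \<noteq> []"
    using cycle_graph_cyclic_order[OF assms] by blast
  have connected: "connected C"
    using connected_arc[of C vs "[]"] graph vs induce_subgraph_verts_self[OF graph]
    by (simp add: cyclic_order_def)
  have "weighted_safe_number C w = connected_weighted_safe_number C w"
    if pos: "w \<in> weight_functions C" for w
  proof (rule antisym)
    note finite = finite_safe_set_weights[OF graph, of w]
    note nonempty = safe_set_weights_nonempty[OF graph connected, of w]
    show "weighted_safe_number C w \<le> connected_weighted_safe_number C w"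
      unfolding weighted_safe_number_def connected_weighted_safe_number_def
      by (rule Min_antimono[OF _ nonempty(2) finite(1)])
         (auto simp: connected_weighted_safe_set_def)
    obtain S where S: "weighted_safe_set C w S" "weighted_safe_number C w = sum w S"
      using Min_in[OF finite(1) nonempty(1)] unfolding weighted_safe_number_def by blast
    obtain A where A: "connected_weighted_safe_set C w A" "sum w A \<le> sum w S"
    proof (cases "S = verts C")
      case True
      then show thesis
        using that connected_weighted_safe_set_verts[OF graph connected, of w] by simp
    next
      case False
      then show thesis
        using lighter_connected_safe_set[OF graph vs(1) pos S(1)] that by blast
    qed
    have "connected_weighted_safe_number C w \<le> sum w A"
      unfolding connected_weighted_safe_number_def
      by (rule Min_le[OF finite(2)]) (use A(1) in blast)
    then show "connected_weighted_safe_number C w \<le> weighted_safe_number C w"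
      using A(2) S(2) by simp
  qed
  then show ?thesis
    using graph connected by (simp add: cs_graphs_def)
qed

end
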